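(* Let $P$ be a non-commutative Poisson algebra over $K$ such that $(P,\cdot)$ is a right Ore domain, let $\widetilde P$ be its right division ring of fractions, and assume that there is a bracket $\{\cdot,\cdot\}$ on $\widetilde P$ making $\widetilde P$ a non-commutative Poisson algebra such that the natural inclusion $P\hookrightarrow\widetilde P$ is a Poisson homomorphism. Assume $x\in P$ satisfies $F(x,P)=P$. Then $$F(x,\widetilde P)=PC^{-1},\qquad\text{where } C=\Big(\bigcup_{\lambda\in Ev(x,P)}D(x,P,\lambda)\Big)\setminus\{0\}$$ and $PC^{-1}=\{uw^{-1}\mid u\in P,\ w\in C\}\subseteq\widetilde P$.
   Context: $K$ is an algebraically closed field of characteristic zero. A non-commutative Poisson algebra over $K$ is a $K$-vector space $P$ with a bilinear product $\cdot$ making it a unital associative (not necessarily commutative) $K$-algebra and a bilinear bracket $\{\cdot,\cdot\}$ making it a Lie algebra, such that $\{x,yz\}=\{x,y\}z+y\{x,z\}$ for all $x,y,z\in P$. A Poisson homomorphism is a $K$-linear map that is a homomorphism of associative algebras and of Lie algebras. $P$ is identified with its image in $\widetilde P$. For a non-commutative Poisson algebra $Q$ (here $Q=P$ or $\widetilde P$) and $x\in Q$, put $ad_x(w)=\{x,w\}$ and $Ev(x,Q)=\{\lambda\in K\mid \exists y\in Q\setminus\{0\},\ ad_x(y)=\lambda y\}$, $D(x,Q,\lambda)=\{y\in Q\mid ad_x(y)=\lambda y\}$, $F(x,Q)=\{y\in Q\mid \dim_K K[ad_x](y)<\infty\}$ (the torsion algebra of $x$ in $Q$). *)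

theory Defs
  imports Complex_Main "HOL-Computational_Algebra.Polynomial"
begin

text \<open>
  The associative unital ring structure is that of the underlying type; the scalar action and the
  bracket are parameters. The Leibniz rule is only required for derivations in the second argument;
  the other one follows from antisymmetry.
\<close>

locale nc_poisson_algebra = vector_space scale
  for scale :: "'k::field \<Rightarrow> 'p::ring_1 \<Rightarrow> 'p" +
  fixes bracket :: "'p \<Rightarrow> 'p \<Rightarrow> 'p"
  assumes linear_mult_left: "Vector_Spaces.linear scale scale (\<lambda>a. a * b)"
    and linear_mult_right: "Vector_Spaces.linear scale scale (\<lambda>b. a * b)"
    and linear_bracket_left: "Vector_Spaces.linear scale scale (\<lambda>a. bracket a b)"
    and linear_bracket_right: "Vector_Spaces.linear scale scale (\<lambda>b. bracket a b)"
    and bracket_self: "bracket a a = 0"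
    and jacobi: "bracket a (bracket b c) + bracket b (bracket c a) + bracket c (bracket a b) = 0"
    and leibniz: "bracket a (b * c) = bracket a b * c + b * bracket a c"
begin

definition ad :: "'p \<Rightarrow> 'p \<Rightarrow> 'p" where
  "ad x w = bracket x w"

definition Ev :: "'p \<Rightarrow> 'k set" where
  "Ev x = {l. \<exists>y. y \<noteq> 0 \<and> ad x y = scale l y}"

definition D :: "'p \<Rightarrow> 'k \<Rightarrow> 'p set" where
  "D x l = {y. ad x y = scale l y}"

definition finite_dimensional_subspace :: "'p set \<Rightarrow> bool" where
  "finite_dimensional_subspace V \<longleftrightarrow> (\<exists>B. finite B \<and> independent B \<and> span B = V)"

definition ad_orbit :: "'p \<Rightarrow> 'p \<Rightarrow> 'p set"  \<comment> \<open>the cyclic module \<open>K[ad\<^sub>x](y)\<close>\<close>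
  where "ad_orbit x y = {\<Sum>i\<le>degree p. scale (coeff p i) ((ad x ^^ i) y) | p :: 'k poly. True}"

definition F :: "'p \<Rightarrow> 'p set" where
  "F x = {y. finite_dimensional_subspace (ad_orbit x y)}"

end

locale nc_poisson_hom =
  source: nc_poisson_algebra scale1 bracket1 + target: nc_poisson_algebra scale2 bracket2
  for scale1 :: "'k::field \<Rightarrow> 'p::ring_1 \<Rightarrow> 'p" and bracket1
    and scale2 :: "'k \<Rightarrow> 'q::ring_1 \<Rightarrow> 'q" and bracket2 +
  fixes f :: "'p \<Rightarrow> 'q"
  assumes linear: "Vector_Spaces.linear scale1 scale2 f"
    and mult: "f (a * b) = f a * f b"
    and one: "f 1 = 1"
    and bracket: "f (bracket1 a b) = bracket2 (f a) (f b)"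

class right_ore_domain = ring_1_no_zero_divisors +
  assumes right_ore: "a \<noteq> 0 \<Longrightarrow> b \<noteq> 0 \<Longrightarrow> \<exists>c d. a * c = b * d \<and> a * c \<noteq> 0"

text \<open>
  A right division ring of fractions is unique up to unique isomorphism, so it is represented by
  any division ring together with an embedding for which every element is a right fraction.
\<close>

locale right_division_ring_of_fractions =
  fixes \<iota> :: "'p::right_ore_domain \<Rightarrow> 'q::division_ring"
  assumes embed_add: "\<iota> (a + b) = \<iota> a + \<iota> b"
    and embed_mult: "\<iota> (a * b) = \<iota> a * \<iota> b"
    and embed_one: "\<iota> 1 = 1"
    and embed_inj: "inj \<iota>"
    and fraction: "\<exists>u w. w \<noteq> 0 \<and> q = \<iota> u * inverse (\<iota> w)"

end

theory Submission
  imports Defs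
begin

text \<open>
  Write \<open>\<delta>\<close> for \<open>ad\<^sub>x\<close>. If \<open>w\<close> is an eigenvector of \<open>\<delta>\<close> with eigenvalue \<open>\<lambda>\<close>, then
  \<open>\<delta> (u w\<inverse>) = ((\<delta> - \<lambda>) u) w\<inverse>\<close>, so the \<open>\<delta>\<close>-orbit of \<open>u w\<inverse>\<close> stays in the image of
  the finite-dimensional space \<open>K[\<delta>] u\<close> under multiplication by \<open>w\<inverse>\<close>. Conversely, let \<open>V = K[\<delta>] q\<close>
  be finite-dimensional. The common denominators of \<open>V\<close> form the right ideal
  \<open>{w \<in> P. V w \<subseteq> P}\<close>, which is nonzero and, since \<open>v (\<delta> w) = \<delta> (v w) - (\<delta> v) w\<close>, stable under \<open>\<delta>\<close>.
  As \<open>\<delta>\<close> is locally finite on \<open>P\<close> and \<open>K\<close> is algebraically closed, this ideal contains an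
  eigenvector \<open>w\<close>, and \<open>q = (q w) w\<inverse>\<close>.
\<close>

section \<open>Cyclic subspaces of an endomorphism\<close>

text \<open>This is p(T) y. The sum has the shape of the one in \<open>ad_orbit\<close>, so
  unfolding identifies that set with a range of \<open>poly_act\<close>.\<close>

definition poly_act :: "('a::zero \<Rightarrow> 'b::comm_monoid_add \<Rightarrow> 'b) \<Rightarrow> ('b \<Rightarrow> 'b) \<Rightarrow> 'a poly \<Rightarrow> 'b \<Rightarrow> 'b"
  where "poly_act scale T p y = (\<Sum>i\<le>degree p. scale (coeff p i) ((T ^^ i) y))"

context vector_space
begin

text \<open>Padding with zero coefficients puts polynomials of different degrees over one common
  index range.\<close>

lemma poly_act_altdef:
  assumes "degree p \<le> n"
  shows "poly_act scale T p y = (\<Sum>i\<le>n. scale (coeff p i) ((T ^^ i) y))"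
  unfolding poly_act_def
  by (rule sum.mono_neutral_left) (use assms in \<open>auto simp: coeff_eq_0\<close>)

lemma poly_act_0 [simp]: "poly_act scale T 0 y = 0"
  by (simp add: poly_act_def)

lemma poly_act_add: "poly_act scale T (p + q) y = poly_act scale T p y + poly_act scale T q y"
proof -
  define n where "n = max (degree p) (degree q)"
  have "degree (p + q) \<le> n" "degree p \<le> n" "degree q \<le> n"
    by (auto simp: n_def degree_add_le_max)
  then show ?thesis
    by (simp add: poly_act_altdef[of _ n] scale_left_distrib sum.distrib)
qed

lemma poly_act_smult: "poly_act scale T (smult c p) y = scale c (poly_act scale T p y)"
  using degree_smult_le[of c p]
  by (simp add: poly_act_altdef[of _ "degree p"] scale_sum_right)

lemma poly_act_monom: "poly_act scale T (monom c n) y = scale c ((T ^^ n) y)"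
proof -
  have "poly_act scale T (monom c n) y = (\<Sum>i\<le>n. scale (coeff (monom c n) i) ((T ^^ i) y))"
    by (rule poly_act_altdef) (rule degree_monom_le)
  also have "\<dots> = (\<Sum>i\<le>n. if i = n then scale c ((T ^^ n) y) else 0)"
    by (rule sum.cong) auto
  finally show ?thesis by simp
qed

text \<open>Horner's scheme: multiplying a polynomial by the variable corresponds to applying
  T.\<close>

lemma poly_act_pCons:
  assumes "Vector_Spaces.linear scale scale T"
  shows "poly_act scale T (pCons c p) y = scale c y + T (poly_act scale T p y)"
proof -
  interpret T: Vector_Spaces.linear scale scale T by fact
  have "poly_act scale T (pCons c p) y
      = (\<Sum>i\<le>Suc (degree p). scale (coeff (pCons c p) i) ((T ^^ i) y))"
    by (rule poly_act_altdef) (rule degree_pCons_le)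
  then show ?thesis
    by (simp add: sum.atMost_Suc_shift poly_act_def T.sum T.scale del: sum.atMost_Suc)
qed

lemma range_poly_act: "range (\<lambda>p. poly_act scale T p y) = span (range (\<lambda>i. (T ^^ i) y))"
proof
  show "range (\<lambda>p. poly_act scale T p y) \<subseteq> span (range (\<lambda>i. (T ^^ i) y))"
    by (auto simp: poly_act_def intro!: span_sum span_scale intro: span_base)
  have "subspace (range (\<lambda>p. poly_act scale T p y))"
    unfolding subspace_def image_def
    by (auto simp flip: poly_act_add poly_act_smult intro: exI[of _ 0])
  moreover have "(T ^^ i) y \<in> range (\<lambda>p. poly_act scale T p y)" for i
    using poly_act_monom[of T 1 i y] by (auto simp: image_iff) metis
  ultimately show "span (range (\<lambda>i. (T ^^ i) y)) \<subseteq> range (\<lambda>p. poly_act scale T p y)"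
    by (intro span_minimal) auto
qed

text \<open>A maximal independent subset of V spans V, and since it lies in the span of B it has at
  most as many elements as B.\<close>

lemma subspace_finite_basis:
  assumes "subspace V" "finite B" "V \<subseteq> span B"
  shows "\<exists>B'. finite B' \<and> independent B' \<and> span B' = V"
proof -
  obtain B' where B': "B' \<subseteq> V" "independent B'" "V \<subseteq> span B'"
    using maximal_independent_subset by blast
  have "finite B'"
    using independent_span_bound[OF \<open>finite B\<close> B'(2)] B'(1) assms(3) by blast
  then show ?thesis
    using B' span_minimal[OF B'(1) assms(1)] by blast
qed

text \<open>If no iterate lay in the span of the earlier ones, the first n iterates would be n
  independent vectors for every n, too many once n exceeds the size of B. A dependent iterate yields
  the polynomial.\<close>

lemma exists_annihilating_poly:
  assumes "finite B" and orbit: "\<And>i. (T ^^ i) y \<in> span B"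
  shows "\<exists>p. p \<noteq> 0 \<and> poly_act scale T p y = 0"
proof -
  define S where "S n = (\<lambda>i. (T ^^ i) y) ` {..<n}" for n
  have "\<exists>n. (T ^^ n) y \<in> span (S n)"
  proof (rule ccontr)
    assume "\<not> ?thesis"
    then have not_in: "(T ^^ n) y \<notin> span (S n)" for n by blast
    have "independent (S n) \<and> card (S n) = n" for n
    proof (induction n)
      case 0
      show ?case by (simp add: S_def independent_empty)
    next
      case (Suc n)
      have "S (Suc n) = insert ((T ^^ n) y) (S n)" "finite (S n)"
        by (auto simp: S_def lessThan_Suc)
      with Suc not_in[of n] show ?case
        using span_base by (auto simp: independent_insert)
    qed
    from this[of "Suc (card B)"] show False
      using independent_span_bound[OF \<open>finite B\<close>, of "S (Suc (card B))"] orbit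
      by (fastforce simp: S_def)
  qed
  then obtain n where n: "(T ^^ n) y \<in> span (S n)" by blast
  \<comment> \<open>The coefficients from n on are kept zero so that subtracting p from the n-th
    power of the variable leaves leading coefficient 1.\<close>
  have "\<exists>p. (\<forall>i\<ge>n. coeff p i = 0) \<and> poly_act scale T p y = v" if "v \<in> span (S n)" for v
    using that
  proof (induction rule: span_induct_alt)
    case base
    show ?case by (rule exI[of _ 0]) simp
  next
    case (step c s v)
    then obtain p i where "\<forall>i\<ge>n. coeff p i = 0" "poly_act scale T p y = v" "i < n" "s = (T ^^ i) y"
      by (auto simp: S_def)
    then show ?case
      by (intro exI[of _ "monom c i + p"]) (simp add: poly_act_add poly_act_monom)
  qed
  from this[OF n] obtain p
    where p: "\<And>i. i \<ge> n \<Longrightarrow> coeff p i = 0" "poly_act scale T p y = (T ^^ n) y" by blast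
  have "coeff (monom 1 n + smult (-1) p) n \<noteq> 0"
    by (simp add: p(1))
  then have "monom 1 n + smult (-1) p \<noteq> 0" by force
  moreover have "poly_act scale T (monom 1 n + smult (-1) p) y = 0"
    unfolding poly_act_add poly_act_smult poly_act_monom by (simp add: p(2))
  ultimately show ?thesis by blast
qed

section \<open>Eigenvectors in an invariant subspace\<close>

lemma poly_act_mem:
  assumes "subspace S" "\<And>v. v \<in> S \<Longrightarrow> T v \<in> S" "y \<in> S"
  shows "poly_act scale T p y \<in> S"
proof -
  have "(T ^^ i) y \<in> S" for i
    by (induction i) (auto intro: assms)
  then show ?thesis
    using assms(1) by (auto simp: poly_act_def intro!: subspace_sum subspace_scale)
qed

lemma poly_act_linear_factor:
  assumes "Vector_Spaces.linear scale scale T"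
  shows "poly_act scale T ([:- l, 1:] * r) y
      = T (poly_act scale T r y) - scale l (poly_act scale T r y)"
  using poly_act_pCons[OF assms, of 0 r y]
    poly_act_add[of T "smult (- l) r" "pCons 0 r" y] poly_act_smult[of T "- l" r y]
  by simp

end

text \<open>Induction on the degree of a polynomial annihilating y. Split off a root as p = (X - l)
  r: if r(T) y = 0, the degree has dropped; otherwise r(T) y is an eigenvector for l, and it lies in
  S because S is stable.\<close>

lemma exists_eigenvector:
  fixes scale :: "'k::alg_closed_field \<Rightarrow> 'v::ab_group_add \<Rightarrow> 'v"
  assumes "vector_space scale" and lin: "Vector_Spaces.linear scale scale T"
    and S: "module.subspace scale S" "\<And>v. v \<in> S \<Longrightarrow> T v \<in> S"
    and y: "y \<in> S" "y \<noteq> 0"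
    and B: "finite B" "\<And>i. (T ^^ i) y \<in> module.span scale B"
  shows "\<exists>l v. v \<in> S \<and> v \<noteq> 0 \<and> T v = scale l v"
proof -
  interpret vector_space scale by fact
  interpret T: Vector_Spaces.linear scale scale T by fact
  have "\<exists>l v. v \<in> S \<and> v \<noteq> 0 \<and> T v = scale l v" if "p \<noteq> 0" "poly_act scale T p y = 0" for p
    using that
  proof (induction "degree p" arbitrary: p rule: less_induct)
    case less
    \<comment> \<open>A nonzero constant does not annihilate the nonzero y, so p has a root.\<close>
    have "degree p > 0"
    proof (rule ccontr)
      assume "\<not> degree p > 0"
      then obtain c where "p = [:c:]" using degree_eq_zeroE by blast
      with less.prems y(2) show False
        using poly_act_pCons[OF lin, of c 0 y] T.zero by simp
    qed
    then obtain l where "poly p l = 0" using alg_closed_imp_poly_has_root by blast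
    then obtain r where r: "p = [:- l, 1:] * r"
      using poly_eq_0_iff_dvd by (metis dvdE)
    with less.prems have r0: "r \<noteq> 0" by auto
    have "degree r < degree p"
      unfolding r using r0 by (subst degree_mult_eq) auto
    show ?case
    proof (cases "poly_act scale T r y = 0")
      case True
      then show ?thesis using less.hyps \<open>degree r < degree p\<close> r0 by blast
    next
      case False
      moreover have "poly_act scale T r y \<in> S" by (rule poly_act_mem[OF S y(1)])
      moreover have "T (poly_act scale T r y) = scale l (poly_act scale T r y)"
        using less.prems(2) poly_act_linear_factor[OF lin, of l r y] r by simp
      ultimately show ?thesis by blast
    qed
  qed
  then show ?thesis using exists_annihilating_poly[OF B] by blast
qed

section \<open>The torsion algebra\<close>

context nc_poisson_algebra
begin

lemma linear_ad: "Vector_Spaces.linear scale scale (ad x)"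
  unfolding ad_def by (rule linear_bracket_right)

lemma ad_mult: "ad x (a * b) = ad x a * b + a * ad x b"
  by (simp add: ad_def leibniz)

lemma ad_one: "ad x 1 = 0"
  using ad_mult[of x 1 1] by simp

lemma scale_mult_left: "scale c a * b = scale c (a * b)"
  using linear_mult_left[of b] by (simp add: Vector_Spaces.linear_iff)

lemma scale_mult_right: "a * scale c b = scale c (a * b)"
  using linear_mult_right[of a] by (simp add: Vector_Spaces.linear_iff)

lemma ad_orbit_eq_span: "ad_orbit x y = span (range (\<lambda>i. (ad x ^^ i) y))"
  unfolding range_poly_act[symmetric] by (auto simp: ad_orbit_def poly_act_def)

text \<open>Subspaces of finite-dimensional spaces are finite-dimensional, so any finite B whose
  span contains the orbit will do; B itself may lie outside the orbit.\<close>

lemma mem_F_iff: "y \<in> F x \<longleftrightarrow> (\<exists>B. finite B \<and> (\<forall>i. (ad x ^^ i) y \<in> span B))"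
proof
  assume "y \<in> F x"
  then obtain B where "finite B" "span B = span (range (\<lambda>i. (ad x ^^ i) y))"
    by (auto simp: F_def finite_dimensional_subspace_def ad_orbit_eq_span)
  then show "\<exists>B. finite B \<and> (\<forall>i. (ad x ^^ i) y \<in> span B)"
    by (metis rangeI span_base)
next
  assume "\<exists>B. finite B \<and> (\<forall>i. (ad x ^^ i) y \<in> span B)"
  then obtain B where "finite B" "span (range (\<lambda>i. (ad x ^^ i) y)) \<subseteq> span B"
    by (metis image_subsetI span_minimal subspace_span)
  then show "y \<in> F x"
    unfolding F_def finite_dimensional_subspace_def ad_orbit_eq_span
    using subspace_finite_basis[OF subspace_span] by blast
qed

lemma ad_orbit_stable:
  assumes "v \<in> ad_orbit x y"
  shows "ad x v \<in> ad_orbit x y"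
proof -
  interpret T: Vector_Spaces.linear scale scale "ad x" by (rule linear_ad)
  have "ad x ((ad x ^^ i) y) \<in> range (\<lambda>i. (ad x ^^ i) y)" for i
    by (rule range_eqI[of _ _ "Suc i"]) simp
  then have "ad x ` range (\<lambda>i. (ad x ^^ i) y) \<subseteq> range (\<lambda>i. (ad x ^^ i) y)"
    by blast
  then have "ad x ` span (range (\<lambda>i. (ad x ^^ i) y)) \<subseteq> span (range (\<lambda>i. (ad x ^^ i) y))"
    unfolding T.span_image[symmetric] by (rule span_mono)
  then show ?thesis
    using assms by (auto simp only: ad_orbit_eq_span)
qed

lemma self_mem_ad_orbit: "y \<in> ad_orbit x y"
  unfolding ad_orbit_eq_span by (rule span_base) (auto intro: range_eqI[of _ _ 0])

lemma F_iff_ad_orbit: "y \<in> F x \<longleftrightarrow> (\<exists>B. finite B \<and> span B = ad_orbit x y)"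
  unfolding F_def finite_dimensional_subspace_def mem_Collect_eq ad_orbit_eq_span
  using subspace_finite_basis[OF subspace_span] by (metis order_refl)

end

text \<open>Apply the derivation to w^-1 w = 1, whose bracket with x vanishes, and cancel w from the
  right.\<close>

lemma ad_inverse_eigenvector:
  fixes scale :: "'k::field \<Rightarrow> 'q::division_ring \<Rightarrow> 'q"
  assumes "nc_poisson_algebra scale bracket"
    and w: "w \<noteq> 0" "nc_poisson_algebra.ad bracket x w = scale l w"
  shows "nc_poisson_algebra.ad bracket x (inverse w) = - scale l (inverse w)"
proof -
  interpret nc_poisson_algebra scale bracket by fact
  have "ad x (inverse w) * w + scale l 1 = 0"
    using w ad_mult[of x "inverse w" w] by (simp add: ad_one scale_mult_right)
  then have "ad x (inverse w) * w = - scale l 1"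
    by (rule eq_neg_iff_add_eq_0[THEN iffD2])
  then have "ad x (inverse w) * w * inverse w = - scale l (inverse w)"
    by (simp add: scale_mult_left)
  then show ?thesis using w by (simp add: mult.assoc)
qed

section \<open>Fractions\<close>

lemma (in right_division_ring_of_fractions) embed_eq_0_iff: "\<iota> a = 0 \<longleftrightarrow> a = 0"
proof -
  have "\<iota> 0 = 0" using embed_add[of 0 0] by simp
  then show ?thesis using embed_inj by (metis injD)
qed

text \<open>Induction on B. If w clears the denominators of B and b w = u s^-1, then w s clears b as
  well, and it still clears B because the image of \<open>\<iota>\<close> is closed under
  multiplication.\<close>

lemma (in right_division_ring_of_fractions) common_denominator:
  assumes "finite B"
  shows "\<exists>w. w \<noteq> 0 \<and> (\<forall>b\<in>B. b * \<iota> w \<in> range \<iota>)"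
  using assms
proof (induction rule: finite_induct)
  case empty
  show ?case by (rule exI[of _ 1]) simp
next
  case (insert b B)
  then obtain w where w: "w \<noteq> 0" "\<And>b. b \<in> B \<Longrightarrow> b * \<iota> w \<in> range \<iota>" by blast
  obtain u s where s: "s \<noteq> 0" "b * \<iota> w = \<iota> u * inverse (\<iota> s)" using fraction by blast
  have "b * \<iota> (w * s) = \<iota> u * inverse (\<iota> s) * \<iota> s"
    by (simp add: embed_mult flip: s(2) mult.assoc)
  also have "\<dots> = \<iota> u" using s(1) by (simp add: mult.assoc embed_eq_0_iff)
  finally have "b * \<iota> (w * s) \<in> range \<iota>" by simp
  moreover have "c * \<iota> (w * s) \<in> range \<iota>" if c: "c \<in> B" for c
  proof -
    obtain v where "c * \<iota> w = \<iota> v" using w(2)[OF c] by blast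
    then have "c * \<iota> (w * s) = \<iota> (v * s)" by (simp add: embed_mult flip: mult.assoc)
    then show ?thesis by simp
  qed
  ultimately show ?case
    using w(1) s(1) by (intro exI[of _ "w * s"]) auto
qed

text \<open>Right multiplication by w^-1 turns \<open>ad x\<close> minus l on P into
  \<open>ad (\<iota> x)\<close>. The orbit space of u is stable under the former, so its
  finite-dimensional image contains all iterates of the fraction.\<close>

lemma fraction_mem_F:
  fixes scaleP :: "'k::field \<Rightarrow> 'p::ring_1 \<Rightarrow> 'p"
    and scaleQ :: "'k \<Rightarrow> 'q::division_ring \<Rightarrow> 'q"
  assumes "nc_poisson_hom scaleP bracketP scaleQ bracketQ \<iota>"
    and u: "u \<in> nc_poisson_algebra.F scaleP bracketP x"
    and w: "\<iota> w \<noteq> 0" "nc_poisson_algebra.ad bracketP x w = scaleP l w"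
  shows "\<iota> u * inverse (\<iota> w) \<in> nc_poisson_algebra.F scaleQ bracketQ (\<iota> x)"
proof -
  interpret hom: nc_poisson_hom scaleP bracketP scaleQ bracketQ \<iota> by fact
  interpret \<iota>: Vector_Spaces.linear scaleP scaleQ \<iota> by (rule hom.linear)
  define g where "g v = \<iota> v * inverse (\<iota> w)" for v
  interpret g: Vector_Spaces.linear scaleP scaleQ g
    by unfold_locales
      (simp_all add: g_def \<iota>.add \<iota>.scale distrib_right hom.target.scale_mult_left)
  have ad_hom: "hom.target.ad (\<iota> x) (\<iota> v) = \<iota> (hom.source.ad x v)" for v
    by (simp add: hom.source.ad_def hom.target.ad_def hom.bracket)
  have "hom.target.ad (\<iota> x) (inverse (\<iota> w)) = - scaleQ l (inverse (\<iota> w))"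
    by (rule ad_inverse_eigenvector[OF hom.target.nc_poisson_algebra_axioms])
      (simp_all add: w ad_hom \<iota>.scale)
  \<comment> \<open>In the Leibniz rule, the derivative of the factor w^-1 contributes the shift by
    -l.\<close>
  then have ad_g: "hom.target.ad (\<iota> x) (g v) = g (hom.source.ad x v - scaleP l v)" for v
    by (simp add: g_def hom.target.ad_mult ad_hom \<iota>.diff \<iota>.scale algebra_simps
        hom.target.scale_mult_left hom.target.scale_mult_right)
  obtain B where B: "finite B" "hom.source.span B = hom.source.ad_orbit x u"
    using u hom.source.F_iff_ad_orbit by blast
  have "(hom.target.ad (\<iota> x) ^^ i) (g u) \<in> g ` hom.source.span B" for i
  proof (induction i)
    case 0
    show ?case by (simp add: B(2) hom.source.self_mem_ad_orbit)
  next
    case (Suc i)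
    then obtain v where v: "v \<in> hom.source.span B" "(hom.target.ad (\<iota> x) ^^ i) (g u) = g v"
      by blast
    then have "hom.source.ad x v - scaleP l v \<in> hom.source.span B"
      by (metis B(2) hom.source.ad_orbit_stable hom.source.span_diff hom.source.span_scale)
    then show ?case by (simp add: v(2) ad_g)
  qed
  then have "g u \<in> hom.target.F (\<iota> x)"
    unfolding hom.target.mem_F_iff using B(1)
    by (intro exI[of _ "g ` B"]) (simp add: g.span_image)
  then show ?thesis by (simp add: g_def)
qed

lemma mem_F_is_fraction:
  fixes scaleP :: "'k::alg_closed_field \<Rightarrow> 'p::right_ore_domain \<Rightarrow> 'p"
    and scaleQ :: "'k \<Rightarrow> 'q::division_ring \<Rightarrow> 'q"
  assumes "right_division_ring_of_fractions \<iota>"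
    and "nc_poisson_hom scaleP bracketP scaleQ bracketQ \<iota>"
    and locally_finite: "nc_poisson_algebra.F scaleP bracketP x = UNIV"
    and q: "q \<in> nc_poisson_algebra.F scaleQ bracketQ (\<iota> x)"
  shows "\<exists>u w l. w \<noteq> 0 \<and> nc_poisson_algebra.ad bracketP x w = scaleP l w
    \<and> q = \<iota> u * inverse (\<iota> w)"
proof -
  interpret fr: right_division_ring_of_fractions \<iota> by fact
  interpret hom: nc_poisson_hom scaleP bracketP scaleQ bracketQ \<iota> by fact
  interpret \<iota>: Vector_Spaces.linear scaleP scaleQ \<iota> by (rule hom.linear)
  have ad_hom: "hom.target.ad (\<iota> x) (\<iota> v) = \<iota> (hom.source.ad x v)" for v
    by (simp add: hom.source.ad_def hom.target.ad_def hom.bracket)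
  have range: "hom.target.subspace (range \<iota>)"
    using \<iota>.subspace_image[OF hom.source.subspace_UNIV] .
  define V where "V = hom.target.ad_orbit (\<iota> x) q"
  \<comment> \<open>Clearing the whole orbit V, not just q, is what makes I stable under
    \<open>ad x\<close>: the Leibniz rule brings in the derivative of v along with v.\<close>
  define I where "I = {w. \<forall>v\<in>V. v * \<iota> w \<in> range \<iota>}"
  obtain B where B: "finite B" "hom.target.span B = V"
    using q hom.target.F_iff_ad_orbit V_def by blast
  obtain w0 where w0: "w0 \<noteq> 0" "\<And>b. b \<in> B \<Longrightarrow> b * \<iota> w0 \<in> range \<iota>"
    using fr.common_denominator[OF B(1)] by blast
  interpret mult_w0: Vector_Spaces.linear scaleQ scaleQ "\<lambda>v. v * \<iota> w0"
    by (rule hom.target.linear_mult_left)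
  \<comment> \<open>The elements cleared by w0 form a subspace, so clearing the finite spanning set
    B clears all of V.\<close>
  have "hom.target.subspace {v. v * \<iota> w0 \<in> range \<iota>}"
    using mult_w0.subspace_vimage[OF range] by (simp add: vimage_def)
  then have "V \<subseteq> {v. v * \<iota> w0 \<in> range \<iota>}"
    unfolding B(2)[symmetric] using w0(2) by (intro hom.target.span_minimal) auto
  then have "w0 \<in> I" by (auto simp: I_def)
  have "hom.source.subspace I"
    unfolding hom.source.subspace_def I_def
    using hom.target.subspace_0[OF range] hom.target.subspace_add[OF range]
      hom.target.subspace_scale[OF range]
    by (auto simp only: mem_Collect_eq \<iota>.add \<iota>.zero \<iota>.scale distrib_left mult_zero_right
        hom.target.scale_mult_right)
  moreover have "hom.source.ad x w \<in> I" if w: "w \<in> I" for w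
  proof -
    have "v * \<iota> (hom.source.ad x w) \<in> range \<iota>" if v: "v \<in> V" for v
    proof -
      obtain a where a: "v * \<iota> w = \<iota> a" using w v by (auto simp: I_def)
      have "hom.target.ad (\<iota> x) v \<in> V"
        using v hom.target.ad_orbit_stable by (simp add: V_def)
      then obtain b where b: "hom.target.ad (\<iota> x) v * \<iota> w = \<iota> b" using w by (auto simp: I_def)
      \<comment> \<open>Differentiate v w = a; two of the three terms lie in the image of P, hence
        so does the third.\<close>
      have "\<iota> (hom.source.ad x a) = \<iota> b + v * \<iota> (hom.source.ad x w)"
        using hom.target.ad_mult[of "\<iota> x" v "\<iota> w"] by (simp add: a b ad_hom)
      then have "v * \<iota> (hom.source.ad x w) = \<iota> (hom.source.ad x a - b)"
        by (simp add: \<iota>.diff)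
      then show ?thesis by simp
    qed
    then show ?thesis by (simp add: I_def)
  qed
  moreover obtain B' where "finite B'" "\<And>i. (hom.source.ad x ^^ i) w0 \<in> hom.source.span B'"
    using locally_finite hom.source.mem_F_iff by blast
  ultimately obtain l w where w: "w \<in> I" "w \<noteq> 0" "hom.source.ad x w = scaleP l w"
    using exists_eigenvector[OF hom.source.vector_space_axioms hom.source.linear_ad]
      \<open>w0 \<in> I\<close> w0(1) by metis
  \<comment> \<open>q belongs to its own orbit, so w is in particular a denominator of q.\<close>
  obtain u where "q * \<iota> w = \<iota> u"
    using w(1) hom.target.self_mem_ad_orbit[of q "\<iota> x"] by (auto simp: I_def V_def)
  then have "q = \<iota> u * inverse (\<iota> w)"
    using w(2) by (simp add: fr.embed_eq_0_iff mult.assoc flip: \<open>q * \<iota> w = \<iota> u\<close>)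
  with w show ?thesis by blast
qed

theorem theorem4p3:
  fixes scaleP :: "'k::{alg_closed_field, field_char_0} \<Rightarrow> 'p::right_ore_domain \<Rightarrow> 'p"
    and bracketP :: "'p \<Rightarrow> 'p \<Rightarrow> 'p"
    and scaleQ :: "'k \<Rightarrow> 'q::division_ring \<Rightarrow> 'q"
    and bracketQ :: "'q \<Rightarrow> 'q \<Rightarrow> 'q"
    and \<iota> :: "'p \<Rightarrow> 'q"
    and x :: 'p
  defines "C \<equiv> (\<Union>l\<in>nc_poisson_algebra.Ev scaleP bracketP x.
                   nc_poisson_algebra.D scaleP bracketP x l) - {0}"
  assumes "nc_poisson_algebra scaleP bracketP"
    and "right_division_ring_of_fractions \<iota>"
    and "nc_poisson_algebra scaleQ bracketQ"
    and "nc_poisson_hom scaleP bracketP scaleQ bracketQ \<iota>"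
    and "nc_poisson_algebra.F scaleP bracketP x = UNIV"
  shows "nc_poisson_algebra.F scaleQ bracketQ (\<iota> x) = {\<iota> u * inverse (\<iota> w) | u w. w \<in> C}"
proof -
  interpret P: nc_poisson_algebra scaleP bracketP by fact
  interpret fr: right_division_ring_of_fractions \<iota> by fact
  \<comment> \<open>A nonzero w in \<open>D x l\<close> itself witnesses that l lies in
    \<open>Ev x\<close>, so C consists of the eigenvectors of \<open>ad x\<close>.\<close>
  have C: "w \<in> C \<longleftrightarrow> w \<noteq> 0 \<and> (\<exists>l. P.ad x w = scaleP l w)" for w
    by (auto simp: C_def P.Ev_def P.D_def)
  show ?thesis
  proof (intro equalityI subsetI)
    fix q assume "q \<in> nc_poisson_algebra.F scaleQ bracketQ (\<iota> x)"
    then show "q \<in> {\<iota> u * inverse (\<iota> w) | u w. w \<in> C}"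
      using mem_F_is_fraction[OF assms(3,5,6)] C by blast
  next
    fix q assume "q \<in> {\<iota> u * inverse (\<iota> w) | u w. w \<in> C}"
    then show "q \<in> nc_poisson_algebra.F scaleQ bracketQ (\<iota> x)"
      using fraction_mem_F[OF assms(5)] assms(6) by (auto simp: C fr.embed_eq_0_iff)
  qed
qed

end
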